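(* Let $\mathbf M=\{M_k\}_{k\in\mathbb Z}$ be a sequence of Orlicz functions whose conjugate sequence $\mathbf M^*=\{M_k^*\}_{k\in\mathbb Z}$ satisfies $M_k^*(v)>M_k^*(1)=1$ for all $v>1$ and all $k\in\mathbb Z$. Let $f\in L^{\psi}\mathcal S_{\mathbf M}$, $\varphi\in\Phi$, $\tau>0$, $\mu\in\mathcal M(\tau)$ and $\psi\in\Psi$. Then for every $n\in\mathbb N$ $$E_n(f)^*_{\mathbf M}\le \frac{\mu(\tau)-\mu(0)}{I_{n,\varphi}(\tau,\mu)}\,|\psi(n)|\,\Omega_\varphi\Big(f^{\psi},\tau,\mu,\frac{\tau}{n}\Big)^*_{\mathbf M},$$ where $$I_{n,\varphi}(\tau,\mu):=\inf_{k\in\mathbb N,\ k\ge n}\int_0^{\tau}\varphi\Big(\frac{kt}{n}\Big)\,d\mu(t).$$ If, in addition, $\varphi$ is non-decreasing on $[0,\tau]$ and $$I_{n,\varphi}(\tau,\mu)=\int_0^{\tau}\varphi(t)\,d\mu(t),$$ then this inequality cannot be improved and therefore $$\sup_{f\in L^{\psi}\mathcal S_{\mathbf M},\ f\neq \mathrm{const}}\ \frac{E_n(f)^*_{\mathbf M}}{\Omega_\varphi\big(f^{\psi},\tau,\mu,\frac{\tau}{n}\big)^*_{\mathbf M}}=\frac{\mu(\tau)-\mu(0)}{\int_0^{\tau}\varphi(t)\,d\mu(t)}\,|\psi(n)|.$$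
   Context: $L$ is the space of $2\pi$-periodic complex-valued Lebesgue summable functions, with Fourier coefficients $\widehat f(k)=(2\pi)^{-1}\int_0^{2\pi}f(x)e^{-ikx}\,dx$, $k\in\mathbb Z$. Spaces and norm. An Orlicz function is a nondecreasing convex function $M(t)$, $t\ge 0$, with $M(0)=0$ and $M(t)\to\infty$ as $t\to\infty$. For a sequence $\mathbf M=\{M_k\}_{k\in\mathbb Z}$ of Orlicz functions, $\mathcal S_{\mathbf M}$ is the space of all $f\in L$ such that $\inf\{a>0:\sum_{k\in\mathbb Z}M_k(|\widehat f(k)|/a)\le 1\}<\infty$. The conjugate sequence is $M_k^*(v):=\sup\{uv-M_k(u):u\ge 0\}$, $v\ge 0$. $\Lambda$ is the set of sequences $\lambda=\{\lambda_k\}_{k\in\mathbb Z}$ of positive numbers with $\sum_{k\in\mathbb Z}M_k^*(\lambda_k)\le 1$. The Orlicz norm of a complex sequence $\{c_k\}_{k\in\mathbb Z}$ is $\sup\{\sum_{k\in\mathbb Z}\lambda_k|c_k|:\lambda\in\Lambda\}$, and $\|f\|^*_{\mathbf M}$ denotes the Orlicz norm of $\{\widehat f(k)\}_{k\in\mathbb Z}$, $f\in\mathcal S_{\mathbf M}$. Generalized modulus of smoothness. $\Phi$ is the set of all continuous bounded nonnegative even functions $\varphi$ on $\mathbb R$ with $\varphi(0)=0$ such that $\{t\in\mathbb R:\varphi(t)=0\}$ has Lebesgue measure zero. For $\varphi\in\Phi$, $h\in\mathbb R$, $f\in\mathcal S_{\mathbf M}$, $\|\Delta_h^\varphi f\|^*_{\mathbf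 M}$ denotes the Orlicz norm of the sequence $\{\varphi(kh)\widehat f(k)\}_{k\in\mathbb Z}$, and $\omega_\varphi(f,t)^*_{\mathbf M}:=\sup_{|h|\le t}\|\Delta_h^\varphi f\|^*_{\mathbf M}$. For $\tau>0$, $\mathcal M(\tau)$ is the set of all bounded non-decreasing non-constant functions $\mu$ on $[0,\tau]$. For $\mu\in\mathcal M(\tau)$ and $u>0$, $$\Omega_\varphi(f,\tau,\mu,u)^*_{\mathbf M}:=\frac{1}{\mu(\tau)-\mu(0)}\int_0^u\omega_\varphi(f,t)^*_{\mathbf M}\,d\mu\Big(\frac{\tau t}{u}\Big),$$ the integrals with respect to $\mu$ being Stieltjes integrals. $\psi$-derivatives. Let $\psi=\{\psi(k)\}_{k\in\mathbb Z}$ be an arbitrary sequence of complex numbers. If $g\in L$ and $F\in L$ satisfy $\widehat F(k)=\psi(k)\widehat g(k)$ for all $k\in\mathbb Z$, then $F$ is called the $\psi$-integral of $g$, and $g=:F^\psi$ is called the $\psi$-derivative of $F$. $L^\psi\mathcal S_{\mathbf M}$ is the set of all $\psi$-integrals of functions from $\mathcal S_{\mathbf M}$. $\Psi$ is the set of sequences $\psi$ of complex numbers with $|\psi(k)|=|\psi(-k)|\ge|\psi(k+1)|$ for all $k\in\mathbb N=\{1,2,\dots\}$. Best approximation. $E_n(f)^*_{\mathbf M}:=\inf\|f-T_{n-1}\|^*_{\mathbf M}$, the infimum over all trigonometric polynomials $T_{n-1}(x)=\sum_{|k|\le n-1}c_ke^{ikx}$, $c_k\in\mathbb C$. *)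

theory Defs
  imports "HOL-Analysis.Analysis"
begin

(* Elements of L are represented by actual functions rather than by classes modulo
   almost-everywhere equality. *)
definition periodic_L1 :: "(real \<Rightarrow> complex) set" where
  "periodic_L1 = {f. (\<forall>x. f (x + 2 * pi) = f x) \<and> set_integrable lebesgue {0..2 * pi} f}"

definition fourier_coeff :: "(real \<Rightarrow> complex) \<Rightarrow> int \<Rightarrow> complex" where
  "fourier_coeff f k =
     (1 / (2 * pi)) * (LINT x:{0..2 * pi}|lebesgue. f x * exp (- \<i> * of_int k * of_real x))"

(* Only the values of M on [0, oo) are relevant. *)
definition orlicz_function :: "(real \<Rightarrow> real) \<Rightarrow> bool" where
  "orlicz_function M \<longleftrightarrow>
     mono_on {0..} M \<and> convex_on {0..} M \<and> M 0 = 0 \<and> filterlim M at_top at_top"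

(* Norms, conjugates, moduli and integrals of nonnegative functions take values in [0, oo]. *)

definition luxemburg_norm :: "(int \<Rightarrow> real \<Rightarrow> real) \<Rightarrow> (int \<Rightarrow> complex) \<Rightarrow> ennreal" where
  "luxemburg_norm M c =
     (INF a\<in>{a::real. a > 0 \<and> (\<Sum>\<^sub>\<infinity>k. ennreal (M k (cmod (c k) / a))) \<le> 1}. ennreal a)"

definition SM_space :: "(int \<Rightarrow> real \<Rightarrow> real) \<Rightarrow> (real \<Rightarrow> complex) set" where
  "SM_space M = {f \<in> periodic_L1. luxemburg_norm M (fourier_coeff f) < \<infinity>}"

(* ennreal truncates negative reals to 0; this does not change the supremum, since
   u = 0 contributes - M 0 = 0. The conjugate may take the value \<infinity>. *)
definition conjugate :: "(real \<Rightarrow> real) \<Rightarrow> real \<Rightarrow> ennreal" where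
  "conjugate M v = (SUP u\<in>{0..}. ennreal (u * v - M u))"

definition weights :: "(int \<Rightarrow> real \<Rightarrow> real) \<Rightarrow> (int \<Rightarrow> real) set" where
  "weights M = {l. (\<forall>k. l k > 0) \<and> (\<Sum>\<^sub>\<infinity>k. conjugate (M k) (l k)) \<le> 1}"

definition orlicz_norm :: "(int \<Rightarrow> real \<Rightarrow> real) \<Rightarrow> (int \<Rightarrow> complex) \<Rightarrow> ennreal" where
  "orlicz_norm M c = (SUP l\<in>weights M. \<Sum>\<^sub>\<infinity>k. ennreal (l k * cmod (c k)))"

definition Phi_class :: "(real \<Rightarrow> real) set" where
  "Phi_class = {\<phi>. continuous_on UNIV \<phi> \<and> bounded (range \<phi>) \<and> (\<forall>t. \<phi> t \<ge> 0) \<and>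
     (\<forall>t. \<phi> (- t) = \<phi> t) \<and> \<phi> 0 = 0 \<and> {t. \<phi> t = 0} \<in> null_sets lebesgue}"

definition modulus ::
  "(int \<Rightarrow> real \<Rightarrow> real) \<Rightarrow> (real \<Rightarrow> real) \<Rightarrow> (real \<Rightarrow> complex) \<Rightarrow> real \<Rightarrow> ennreal" where
  "modulus M \<phi> f t =
     (SUP h\<in>{h. \<bar>h\<bar> \<le> t}. orlicz_norm M (\<lambda>k. of_real (\<phi> (of_int k * h)) * fourier_coeff f k))"

definition Mu_class :: "real \<Rightarrow> (real \<Rightarrow> real) set" where
  "Mu_class \<tau> = {\<mu>. bounded (\<mu> ` {0..\<tau>}) \<and> mono_on {0..\<tau>} \<mu> \<and> \<not> \<mu> constant_on {0..\<tau>}}"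

(* The Lebesgue-Stieltjes measure on [a, b] of a function \<mu> that is nondecreasing on [a, b]:
   \<mu> is extended by constants beyond a and b and replaced by its right limits, as
   interval_measure requires right continuity. Hence the point masses are
   \<mu>(a+) - \<mu>(a) at a, \<mu>(t+) - \<mu>(t-) at interior t and \<mu>(b) - \<mu>(b-) at b,
   the total mass is \<mu>(b) - \<mu>(a), and for continuous integrands the integral agrees with the
   Riemann-Stieltjes integral. The latter need not exist for the modulus of smoothness, which
   can have jumps at the same points as \<mu>. *)
definition stieltjes_measure :: "real \<Rightarrow> real \<Rightarrow> (real \<Rightarrow> real) \<Rightarrow> real measure" where
  "stieltjes_measure a b \<mu> = interval_measure (\<lambda>t. INF s\<in>{t<..}. \<mu> (max a (min b s)))"

definition stieltjes_integral ::
  "real \<Rightarrow> real \<Rightarrow> (real \<Rightarrow> ennreal) \<Rightarrow> (real \<Rightarrow> real) \<Rightarrow> ennreal" where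
  "stieltjes_integral a b g \<mu> = (\<integral>\<^sup>+t\<in>{a..b}. g t \<partial>stieltjes_measure a b \<mu>)"

definition Omega_modulus ::
  "(int \<Rightarrow> real \<Rightarrow> real) \<Rightarrow> (real \<Rightarrow> real) \<Rightarrow> (real \<Rightarrow> complex) \<Rightarrow> real \<Rightarrow> (real \<Rightarrow> real)
     \<Rightarrow> real \<Rightarrow> ennreal" where
  "Omega_modulus M \<phi> f \<tau> \<mu> u =
     1 / ennreal (\<mu> \<tau> - \<mu> 0) * stieltjes_integral 0 u (modulus M \<phi> f) (\<lambda>t. \<mu> (\<tau> * t / u))"

definition I_const :: "nat \<Rightarrow> (real \<Rightarrow> real) \<Rightarrow> real \<Rightarrow> (real \<Rightarrow> real) \<Rightarrow> ennreal" where
  "I_const n \<phi> \<tau> \<mu> =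
     (INF k\<in>{n..}. stieltjes_integral 0 \<tau> (\<lambda>t. ennreal (\<phi> (real k * t / real n))) \<mu>)"

definition Psi_class :: "(int \<Rightarrow> complex) set" where
  "Psi_class = {\<psi>. \<forall>k\<ge>1. cmod (\<psi> k) = cmod (\<psi> (- k)) \<and> cmod (\<psi> (- k)) \<ge> cmod (\<psi> (k + 1))}"

(* F is the \<psi>-integral of g, and g is a \<psi>-derivative of F. When \<psi> has zeros, F does not
   determine g, so this is kept as a relation. *)
definition psi_integral_of ::
  "(int \<Rightarrow> complex) \<Rightarrow> (real \<Rightarrow> complex) \<Rightarrow> (real \<Rightarrow> complex) \<Rightarrow> bool" where
  "psi_integral_of \<psi> F g \<longleftrightarrow> g \<in> periodic_L1 \<and> F \<in> periodic_L1 \<and>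
     (\<forall>k. fourier_coeff F k = \<psi> k * fourier_coeff g k)"

definition Lpsi_SM :: "(int \<Rightarrow> complex) \<Rightarrow> (int \<Rightarrow> real \<Rightarrow> real) \<Rightarrow> (real \<Rightarrow> complex) set" where
  "Lpsi_SM \<psi> M = {F. \<exists>g\<in>SM_space M. psi_integral_of \<psi> F g}"

definition psi_derivs ::
  "(int \<Rightarrow> complex) \<Rightarrow> (int \<Rightarrow> real \<Rightarrow> real) \<Rightarrow> (real \<Rightarrow> complex) \<Rightarrow> (real \<Rightarrow> complex) set" where
  "psi_derivs \<psi> M F = {g \<in> SM_space M. psi_integral_of \<psi> F g}"

definition trig_poly :: "nat \<Rightarrow> (int \<Rightarrow> complex) \<Rightarrow> real \<Rightarrow> complex" where
  "trig_poly m c x = (\<Sum>k\<in>{- int m..int m}. c k * exp (\<i> * of_int k * of_real x))"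

definition best_approx ::
  "(int \<Rightarrow> real \<Rightarrow> real) \<Rightarrow> nat \<Rightarrow> (real \<Rightarrow> complex) \<Rightarrow> ennreal" where
  "best_approx M n f =
     (INF c. orlicz_norm M (fourier_coeff (\<lambda>x. f x - trig_poly (n - 1) c x)))"

definition ae_const :: "(real \<Rightarrow> complex) \<Rightarrow> bool" where
  "ae_const f \<longleftrightarrow> (\<exists>c. AE x in lebesgue. f x = c)"

end

theory Submission
  imports Defs
begin

text \<open>
  Subtracting the partial sum of its Fourier series of degree \<open>n - 1\<close> from \<open>f\<close> leaves the frequencies \<open>k\<close> with
  \<open>|k| \<ge> n\<close>. There the coefficients of \<open>f\<close> are \<open>\<psi> k\<close> times those of \<open>g = f\<^sup>\<psi>\<close>, and \<open>|\<psi> k| \<le> |\<psi> n|\<close>. So the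
  best approximation of \<open>f\<close> is at most \<open>|\<psi> n|\<close> times the Orlicz norm of the tail of the coefficients of \<open>g\<close>
  (\<open>best_approx_le_psi_tail\<close>).

  By definition of the constant \<open>I\<close>, every tail frequency satisfies \<open>I \<le> \<integral> \<phi> (k s / n) d\<mu>(s)\<close>. Multiplying by
  \<open>\<lambda>\<^sub>k |c\<^sub>k|\<close>, where \<open>c\<close> are the coefficients of \<open>g\<close>, and summing, the right-hand side becomes the integral of a partial
  sum of the Orlicz norm of the generalized difference of \<open>g\<close> with step \<open>s / n\<close>; this is at most the integral of the
  modulus of smoothness at \<open>s / n\<close> (\<open>tail_norm_le_modulus_integral\<close>). The substitution \<open>t = s / n\<close> identifies
  that integral with \<open>\<mu> \<tau> - \<mu> 0\<close> times the averaged modulus (\<open>Omega_modulus_eq\<close>), and the inequality follows.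

  The constant is attained by \<open>g = e\<^sup>i\<^sup>n\<^sup>x\<close> and \<open>f = \<psi> n e\<^sup>i\<^sup>n\<^sup>x\<close>. Let \<open>S\<close> be the Orlicz norm of the unit
  sequence at \<open>n\<close>. Polynomials of degree below \<open>n\<close> cannot touch the coefficient of \<open>f\<close>, so its best approximation is
  \<open>|\<psi> n| S\<close>, while for \<open>\<phi>\<close> nondecreasing on \<open>[0, \<tau>]\<close> the modulus of \<open>g\<close> at \<open>s / n\<close> is \<open>\<phi> s S\<close>. The
  factor \<open>S\<close> cancels because the hypothesis on the conjugate functions makes it positive and finite: weights exist, and none
  of their entries exceeds one (\<open>jackson_constant_optimal\<close>). The integral of \<open>\<phi>\<close> may vanish, namely when \<open>\<mu>\<close>
  has all its mass at zero; if also \<open>\<psi> n \<noteq> 0\<close>, both the constant and the supremum of the quotients are infinite.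
\<close>

section \<open>Fourier coefficients of trigonometric polynomials\<close>

lemma has_integral_character:
  fixes j :: int
  shows "((\<lambda>x. exp (\<i> * of_int j * of_real x)) has_integral (if j = 0 then of_real (2 * pi) else 0)) {0..2 * pi}"
proof (cases "j = 0")
  case True
  then show ?thesis
    using has_integral_const_real[of "1::complex" 0 "2 * pi"] by (simp add: scaleR_conv_of_real)
next
  case False
  define F where "F = (\<lambda>x::real. exp (\<i> * of_int j * of_real x) / (\<i> * of_int j))"
  have "(F has_vector_derivative exp (\<i> * of_int j * of_real x)) (at x within {0..2 * pi})" for x
  proof -
    have "((\<lambda>z. exp (\<i> * of_int j * z) / (\<i> * of_int j)) has_field_derivative exp (\<i> * of_int j * of_real x)) (at (of_real x))"
      using False by (auto intro!: derivative_eq_intros)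
    from has_vector_derivative_real_field[OF this]
    show ?thesis
      unfolding F_def .
  qed
  then have "((\<lambda>x. exp (\<i> * of_int j * of_real x)) has_integral (F (2 * pi) - F 0)) {0..2 * pi}"
    by (intro fundamental_theorem_of_calculus) auto
  moreover have "exp (\<i> * of_int j * of_real (2 * pi)) = 1"
    using exp_integer_2pi[of "of_int j"] by (simp add: mult_ac)
  then have "F (2 * pi) = F 0"
    by (simp add: F_def)
  ultimately show ?thesis
    using False by simp
qed

lemma set_integrable_character: "set_integrable lebesgue {0..2 * pi} (\<lambda>x. exp (\<i> * of_int j * of_real x))"
proof -
  have "continuous_on {0..2 * pi} (\<lambda>x. exp (\<i> * of_int j * complex_of_real x))"
    by (intro continuous_intros)
  then show ?thesis
    using absolutely_integrable_continuous_real by blast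
qed

text \<open>A character is continuous of modulus one, so multiplying by it preserves integrability. The Fourier coefficients of
summable functions are therefore given by genuine integrals and depend linearly on the function.\<close>

lemma set_integrable_times_character:
  assumes "set_integrable lebesgue A f"
  shows "set_integrable lebesgue A (\<lambda>x. f x * exp (- \<i> * of_int k * of_real x))"
proof -
  let ?e = "\<lambda>x. exp (- \<i> * of_int k * complex_of_real x)"
  have f: "integrable lebesgue (\<lambda>x. indicator A x *\<^sub>R f x)"
    using assms unfolding set_integrable_def .
  have "continuous_on UNIV ?e"
    by (intro continuous_intros)
  then have "?e \<in> borel_measurable lborel"
    by (simp add: borel_measurable_continuous_onI)
  then have [measurable]: "?e \<in> borel_measurable lebesgue"
    by (rule measurable_completion)
  have "integrable lebesgue (\<lambda>x. (indicator A x *\<^sub>R f x) * ?e x)"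
  proof (rule Bochner_Integration.integrable_bound[OF f])
    show "(\<lambda>x. (indicator A x *\<^sub>R f x) * ?e x) \<in> borel_measurable lebesgue"
      using f by measurable
  qed (auto simp: norm_mult)
  then show ?thesis
    unfolding set_integrable_def by simp
qed

lemma set_integrable_trig_poly: "set_integrable lebesgue {0..2 * pi} (trig_poly m c)"
proof -
  have "trig_poly m c = (\<lambda>x. \<Sum>k\<in>{- int m..int m}. c k * exp (\<i> * of_int k * of_real x))"
    by (rule ext) (simp add: trig_poly_def)
  moreover have "continuous_on {0..2 * pi} (\<lambda>x. \<Sum>k\<in>{- int m..int m}. c k * exp (\<i> * of_int k * of_real x))"
    by (intro continuous_intros)
  ultimately show ?thesis
    using absolutely_integrable_continuous_real by metis
qed

lemma fourier_coeff_trig_poly: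
  "fourier_coeff (trig_poly m c) k = (if \<bar>k\<bar> \<le> int m then c k else 0)"
proof -
  have eq: "trig_poly m c x * exp (- \<i> * of_int k * of_real x)
      = (\<Sum>j\<in>{- int m..int m}. c j * exp (\<i> * of_int (j - k) * of_real x))" for x
  proof -
    have "exp (\<i> * of_int j * of_real x) * exp (- \<i> * of_int k * of_real x) = exp (\<i> * of_int (j - k) * of_real x)" for j
      unfolding exp_add[symmetric] by (rule arg_cong[where f=exp]) (simp add: algebra_simps)
    then show ?thesis
      by (simp only: trig_poly_def sum_distrib_right mult.assoc)
  qed
  have "((\<lambda>x. trig_poly m c x * exp (- \<i> * of_int k * of_real x)) has_integral
      (\<Sum>j\<in>{- int m..int m}. c j * (if j - k = 0 then of_real (2 * pi) else 0))) {0..2 * pi}"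
    unfolding eq by (intro has_integral_sum has_integral_mult_right has_integral_character) auto
  also have "(\<Sum>j\<in>{- int m..int m}. c j * (if j - k = 0 then of_real (2 * pi) else 0))
      = (\<Sum>j\<in>{- int m..int m}. if j = k then c j * of_real (2 * pi) else 0)"
    by (intro sum.cong) auto
  also have "\<dots> = (if \<bar>k\<bar> \<le> int m then c k * of_real (2 * pi) else 0)"
    by (subst sum.delta) (auto simp: abs_le_iff)
  finally have "integral {0..2 * pi} (\<lambda>x. trig_poly m c x * exp (- \<i> * of_int k * of_real x))
      = (if \<bar>k\<bar> \<le> int m then c k * of_real (2 * pi) else 0)"
    by (rule integral_unique)
  then show ?thesis
    using set_lebesgue_integral_eq_integral(2)[OF set_integrable_times_character[OF set_integrable_trig_poly]]
    by (simp add: fourier_coeff_def)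
qed

lemma fourier_coeff_diff:
  assumes "set_integrable lebesgue {0..2 * pi} f" "set_integrable lebesgue {0..2 * pi} g"
  shows "fourier_coeff (\<lambda>x. f x - g x) k = fourier_coeff f k - fourier_coeff g k"
  unfolding fourier_coeff_def
  by (simp only: left_diff_distrib right_diff_distrib[symmetric]
      set_integral_diff(2)[OF assms[THEN set_integrable_times_character, of k]])

lemma fourier_coeff_minus_trig_poly:
  assumes "f \<in> periodic_L1"
  shows "fourier_coeff (\<lambda>x. f x - trig_poly m c x) k
    = fourier_coeff f k - (if \<bar>k\<bar> \<le> int m then c k else 0)"
  using assms fourier_coeff_diff[OF _ set_integrable_trig_poly]
  by (simp add: periodic_L1_def fourier_coeff_trig_poly)

lemma trig_poly_periodic_L1: "trig_poly m c \<in> periodic_L1"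
proof -
  have "exp (\<i> * of_int k * of_real (x + 2 * pi)) = exp (\<i> * of_int k * of_real x)" for k :: int and x
  proof -
    have "\<i> * of_int k * of_real (x + 2 * pi) = \<i> * of_int k * of_real x + of_int k * (of_real (2 * pi) * \<i>)"
      by (simp add: algebra_simps)
    then show ?thesis
      using exp_integer_2pi[of "of_int k"] by (simp add: exp_add mult_ac)
  qed
  then show ?thesis
    using set_integrable_trig_poly by (simp add: periodic_L1_def trig_poly_def)
qed

text \<open>An almost everywhere constant function is orthogonal to every nontrivial character. In contrapositive form this
shows that the extremal harmonic below is not a constant.\<close>

lemma fourier_coeff_ae_const:
  assumes "AE x in lebesgue. f x = c" and "set_integrable lebesgue {0..2 * pi} f" and "k \<noteq> 0"
  shows "fourier_coeff f k = 0"
proof -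
  let ?e = "\<lambda>x. exp (\<i> * of_int (- k) * complex_of_real x)"
  have "fourier_coeff f k = 1 / (2 * pi) * (LINT x:{0..2 * pi}|lebesgue. c * ?e x)"
    unfolding fourier_coeff_def set_lebesgue_integral_def
  proof (intro arg_cong2[where f="(*)"] refl integral_cong_AE)
    show "(\<lambda>x. indicator {0..2 * pi} x *\<^sub>R (f x * exp (- \<i> * of_int k * of_real x))) \<in> borel_measurable lebesgue"
      using set_integrable_times_character[OF assms(2), of k] unfolding set_integrable_def by auto
    have "set_integrable lebesgue {0..2 * pi} (\<lambda>x. c * ?e x)"
      by (intro set_integrable_mult_right impI set_integrable_character)
    then show "(\<lambda>x. indicator {0..2 * pi} x *\<^sub>R (c * ?e x)) \<in> borel_measurable lebesgue"
      unfolding set_integrable_def by auto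
    show "AE x in lebesgue. indicator {0..2 * pi} x *\<^sub>R (f x * exp (- \<i> * of_int k * of_real x))
        = indicator {0..2 * pi} x *\<^sub>R (c * ?e x)"
      using assms(1) by eventually_elim simp
  qed
  also have "(LINT x:{0..2 * pi}|lebesgue. c * ?e x) = c * (LINT x:{0..2 * pi}|lebesgue. ?e x)"
    by (rule set_integral_mult_right)
  also have "(LINT x:{0..2 * pi}|lebesgue. ?e x) = integral {0..2 * pi} ?e"
    by (rule set_lebesgue_integral_eq_integral(2)[OF set_integrable_character])
  also have "integral {0..2 * pi} ?e = 0"
    using integral_unique[OF has_integral_character[of "- k"]] assms(3) by simp
  finally show ?thesis by simp
qed

section \<open>Orlicz norms, weights and the modulus of smoothness\<close>

text \<open>All terms are nonnegative, so the series in the Orlicz norm are suprema of finite partial sums. In this form every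
estimate of the norm reduces to finite sums, and integration can be exchanged with summation for free.\<close>

lemma orlicz_norm_eq_SUP_finite:
  "orlicz_norm M c = (SUP l\<in>weights M. SUP F\<in>{F. finite F}. \<Sum>k\<in>F. ennreal (l k * cmod (c k)))"
  by (simp add: orlicz_norm_def nonneg_infsum_complete)

lemma orlicz_norm_mono:
  assumes "\<And>k. cmod (c k) \<le> cmod (d k)"
  shows "orlicz_norm M c \<le> orlicz_norm M d"
proof -
  have "ennreal (l k * cmod (c k)) \<le> ennreal (l k * cmod (d k))" if "l \<in> weights M" for l k
    using that assms[of k] unfolding weights_def by (intro ennreal_leI mult_left_mono) (auto intro: less_imp_le)
  then show ?thesis
    unfolding orlicz_norm_eq_SUP_finite by (intro SUP_subset_mono order_refl sum_mono)
qed

lemma orlicz_norm_scale: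
  "orlicz_norm M (\<lambda>k. z * c k) = ennreal (cmod z) * orlicz_norm M c"
proof -
  have "ennreal (l k * cmod (z * c k)) = ennreal (cmod z) * ennreal (l k * cmod (c k))" for l k
    by (simp add: norm_mult ennreal_mult'[symmetric] mult_ac)
  then show ?thesis
    by (simp add: orlicz_norm_eq_SUP_finite SUP_mult_left_ennreal sum_distrib_left)
qed

lemma partial_sum_le_orlicz_norm:
  assumes "l \<in> weights M" "finite F"
  shows "(\<Sum>k\<in>F. ennreal (l k * cmod (c k))) \<le> orlicz_norm M c"
  unfolding orlicz_norm_eq_SUP_finite using assms by (intro SUP_upper2[of l] SUP_upper) auto

lemma modulus_mono: "mono (modulus M \<phi> g)"
  unfolding modulus_def by (intro monoI SUP_subset_mono) auto

text \<open>Sublevel sets of a monotone function are intervals. This gives the measurability of the modulus of smoothness, which is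
needed to change variables in its Stieltjes integral.\<close>

lemma borel_measurable_mono_ennreal:
  fixes f :: "real \<Rightarrow> ennreal"
  assumes "mono f"
  shows "f \<in> borel_measurable borel"
proof (rule borel_measurableI_le)
  fix y
  have "is_interval {x. f x \<le> y}"
    unfolding is_interval_1 using assms by (auto dest: monoD order_trans)
  then show "{x \<in> space borel. f x \<le> y} \<in> sets borel"
    using real_interval_borel_measurable by auto
qed

text \<open>The conjugate is convex and vanishes at zero, so on \<open>[0, 1]\<close> it lies below its chord. The direct argument: since
\<open>M u \<ge> 0\<close> and \<open>v \<le> 1\<close>, \<open>u v - M u \<le> v (u - M u)\<close>.\<close>

lemma conjugate_le_linear:
  assumes M: "orlicz_function M" and v: "0 \<le> v" "v \<le> 1"
  shows "conjugate M v \<le> ennreal v * conjugate M 1"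
  unfolding conjugate_def SUP_mult_left_ennreal
proof (rule SUP_mono)
  fix u :: real assume u: "u \<in> {0..}"
  have "0 \<le> M u"
    using M u unfolding orlicz_function_def by (metis atLeast_iff mono_onD order_refl)
  then have "u * v - M u \<le> v * (u * 1 - M u)"
    using mult_right_mono[of v 1 "M u"] v by (simp add: algebra_simps)
  then show "\<exists>w\<in>{0..}. ennreal (u * v - M u) \<le> ennreal v * ennreal (w * 1 - M w)"
    using u v by (intro bexI[of _ u]) (auto simp: ennreal_mult'[symmetric] intro!: ennreal_leI)
qed

lemma sum_half_power_to_nat_le_1:
  fixes F :: "int set"
  assumes "finite F"
  shows "(\<Sum>k\<in>F. (1/2) ^ Suc (to_nat k)) \<le> (1::real)"
proof -
  have "(\<Sum>k\<in>F. (1/2) ^ Suc (to_nat k)) = (\<Sum>j\<in>to_nat ` F. (1/2::real) ^ Suc j)"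
    by (subst sum.reindex) (auto simp: inj_on_def)
  also have "\<dots> \<le> (\<Sum>j. (1/2) ^ Suc j)"
    using power_half_series assms by (intro sum_le_suminf) (auto simp: sums_iff)
  also have "\<dots> = 1"
    using power_half_series by (simp add: sums_iff)
  finally show ?thesis .
qed

text \<open>By the chord bound any positive sequence with values in \<open>[0, 1]\<close> and sum at most one is an admissible weight; the powers of
one half along an enumeration of the integers form such a sequence. Were the set of weights empty, the Orlicz norm would vanish
identically and the extremal quotient would degenerate.\<close>

lemma weights_nonempty:
  assumes "\<forall>k. orlicz_function (M k)" and "\<forall>k. conjugate (M k) 1 = 1"
  shows "weights M \<noteq> {}"
proof -
  define l :: "int \<Rightarrow> real" where "l = (\<lambda>k. (1/2) ^ Suc (to_nat k))"
  have "(\<Sum>\<^sub>\<infinity>k. conjugate (M k) (l k)) \<le> 1"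
  proof (subst nonneg_infsum_complete, simp, rule SUP_least)
    fix F :: "int set" assume "F \<in> {F. finite F \<and> F \<subseteq> UNIV}"
    then have F: "finite F" by simp
    have "(\<Sum>k\<in>F. conjugate (M k) (l k)) \<le> (\<Sum>k\<in>F. ennreal (l k))"
    proof (rule sum_mono)
      fix k
      have "0 \<le> l k" "l k \<le> 1"
        by (auto simp: l_def power_le_one simp del: power_Suc)
      then show "conjugate (M k) (l k) \<le> ennreal (l k)"
        using conjugate_le_linear[of "M k" "l k"] assms by simp
    qed
    also have "\<dots> = ennreal (\<Sum>k\<in>F. l k)"
      by (subst sum_ennreal) (auto simp: l_def)
    also have "\<dots> \<le> 1"
      using sum_half_power_to_nat_le_1[OF F] by (simp add: l_def)
    finally show "(\<Sum>k\<in>F. conjugate (M k) (l k)) \<le> 1" .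
  qed
  then have "l \<in> weights M"
    by (simp add: weights_def l_def)
  then show ?thesis by auto
qed

text \<open>This is where the growth hypothesis on the conjugate functions enters: a weight exceeding one in a single place would
already violate the constraint on the total.\<close>

lemma weights_le_1:
  assumes conj: "\<forall>k. conjugate (M k) 1 = 1 \<and> (\<forall>v>1. conjugate (M k) v > conjugate (M k) 1)"
    and l: "l \<in> weights M"
  shows "l k \<le> 1"
proof (rule ccontr)
  assume "\<not> l k \<le> 1"
  then have "1 < conjugate (M k) (l k)"
    using conj by (metis not_le)
  also have "\<dots> = (\<Sum>j\<in>{k}. conjugate (M j) (l j))" by simp
  also have "\<dots> \<le> (\<Sum>\<^sub>\<infinity>j. conjugate (M j) (l j))"
    by (subst nonneg_infsum_complete, simp, rule SUP_upper) simp
  also have "\<dots> \<le> 1"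
    using l by (simp add: weights_def)
  finally show False by simp
qed

definition unit_seq :: "int \<Rightarrow> int \<Rightarrow> complex" where
  "unit_seq m = (\<lambda>k. if k = m then 1 else 0)"

lemma orlicz_norm_unit_seq_pos:
  assumes "\<forall>k. orlicz_function (M k)" and "\<forall>k. conjugate (M k) 1 = 1"
  shows "0 < orlicz_norm M (unit_seq m)"
proof -
  obtain l where l: "l \<in> weights M"
    using weights_nonempty assms by blast
  then have "0 < ennreal (l m)"
    by (simp add: weights_def)
  also have "\<dots> \<le> orlicz_norm M (unit_seq m)"
    using partial_sum_le_orlicz_norm[OF l, of "{m}" "unit_seq m"] by (simp add: unit_seq_def)
  finally show ?thesis .
qed

lemma orlicz_norm_unit_seq_le_1:
  assumes "\<forall>k. conjugate (M k) 1 = 1 \<and> (\<forall>v>1. conjugate (M k) v > conjugate (M k) 1)"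
  shows "orlicz_norm M (unit_seq m) \<le> 1"
  unfolding orlicz_norm_eq_SUP_finite
proof (intro SUP_least)
  fix l and F :: "int set" assume l: "l \<in> weights M" and "F \<in> {F. finite F}"
  then have "(\<Sum>k\<in>F. ennreal (l k * cmod (unit_seq m k))) = (\<Sum>k\<in>F. if k = m then ennreal (l m) else 0)"
    by (intro sum.cong) (auto simp: unit_seq_def)
  also have "\<dots> \<le> ennreal (l m)"
    using \<open>F \<in> _\<close> by (simp add: sum.delta)
  also have "\<dots> \<le> 1"
    using weights_le_1[OF assms l, of m] by simp
  finally show "(\<Sum>k\<in>F. ennreal (l k * cmod (unit_seq m k))) \<le> 1" .
qed

lemma luxemburg_norm_unit_seq_finite:
  assumes "\<forall>k. orlicz_function (M k)"
  shows "luxemburg_norm M (unit_seq m) < \<infinity>"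
proof -
  define a where "a = max 1 (M m 1)"
  have a: "a > 0" "a \<ge> 1" "M m 1 \<le> a" by (auto simp: a_def)
  have "convex_on {0..} (M m)" and M0: "M k 0 = 0" for k
    using assms by (auto simp: orlicz_function_def)
  then have "M m ((1 - 1 / a) *\<^sub>R 0 + (1 / a) *\<^sub>R 1) \<le> (1 - 1 / a) * M m 0 + (1 / a) * M m 1"
    using a by (intro convex_onD) auto
  also have "\<dots> \<le> 1"
    using a M0 by (simp add: divide_simps)
  finally have Mm: "M m (1 / a) \<le> 1" by simp
  have "(\<Sum>\<^sub>\<infinity>k. ennreal (M k (cmod (unit_seq m k) / a))) = (\<Sum>\<^sub>\<infinity>k\<in>{m}. ennreal (M k (cmod (unit_seq m k) / a)))"
    by (intro infsum_cong_neutral) (auto simp: unit_seq_def M0)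
  also have "\<dots> \<le> 1"
    using Mm by (simp add: unit_seq_def)
  finally have "luxemburg_norm M (unit_seq m) \<le> ennreal a"
    unfolding luxemburg_norm_def using a by (intro INF_lower) auto
  then show ?thesis
    using ennreal_less_top by (simp add: le_less_trans)
qed

section \<open>Stieltjes integrals under dilation\<close>

text \<open>The distribution function of the Stieltjes measure: the right-continuous version of the extension of \<open>\<mu>\<close> by
constants beyond \<open>a\<close> and \<open>b\<close>.\<close>

definition right_limits :: "real \<Rightarrow> real \<Rightarrow> (real \<Rightarrow> real) \<Rightarrow> real \<Rightarrow> real" where
  "right_limits a b \<mu> t = (INF s\<in>{t<..}. \<mu> (max a (min b s)))"

lemma stieltjes_measure_right_limits: "stieltjes_measure a b \<mu> = interval_measure (right_limits a b \<mu>)"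
  by (simp add: stieltjes_measure_def right_limits_def[abs_def])

lemma bdd_below_clamp:
  assumes "mono_on {a..b} \<mu>" "a \<le> (b::real)"
  shows "bdd_below ((\<lambda>s. \<mu> (max a (min b s)) :: real) ` A)"
proof (rule bdd_belowI2)
  fix s show "\<mu> a \<le> \<mu> (max a (min b s))"
    using assms by (intro mono_onD[OF assms(1)]) auto
qed

lemma right_limits_mono:
  assumes "mono_on {a..b} \<mu>" "a \<le> b" "s \<le> t"
  shows "right_limits a b \<mu> s \<le> right_limits a b \<mu> t"
  unfolding right_limits_def using assms
  by (intro cINF_superset_mono bdd_below_clamp) auto

lemma right_limits_right_continuous:
  assumes "mono_on {a..b} \<mu>" "a \<le> b"
  shows "continuous (at_right t) (right_limits a b \<mu>)"
  unfolding continuous_within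
proof (rule order_tendstoI)
  let ?R = "right_limits a b \<mu>"
  fix y assume y: "y < ?R t"
  have "eventually (\<lambda>x. t < x) (at_right t)"
    by (rule eventually_at_right_less)
  then show "eventually (\<lambda>x. y < ?R x) (at_right t)"
    by eventually_elim (use y right_limits_mono[OF assms] in \<open>meson less_imp_le less_le_trans\<close>)
next
  let ?R = "right_limits a b \<mu>"
  fix y assume "?R t < y"
  then obtain s where s: "t < s" "\<mu> (max a (min b s)) < y"
    unfolding right_limits_def
    by (subst (asm) cINF_less_iff) (auto intro: bdd_below_clamp[OF assms])
  have "eventually (\<lambda>x. x \<in> {t<..<s}) (at_right t)"
    using s(1) by (rule eventually_at_right_real)
  then show "eventually (\<lambda>x. ?R x < y) (at_right t)"
  proof eventually_elim
    case (elim x)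
    then have "?R x \<le> \<mu> (max a (min b s))"
      unfolding right_limits_def by (intro cINF_lower bdd_below_clamp[OF assms]) auto
    with s show ?case by simp
  qed
qed

lemma emeasure_stieltjes_Ioc:
  assumes "mono_on {a..b} \<mu>" "a \<le> b" "c \<le> d"
  shows "emeasure (stieltjes_measure a b \<mu>) {c<..d} = ennreal (right_limits a b \<mu> d - right_limits a b \<mu> c)"
  unfolding stieltjes_measure_right_limits using assms
  by (intro emeasure_interval_measure_Ioc right_limits_mono right_limits_right_continuous)

lemma sets_stieltjes [simp, measurable_cong]: "sets (stieltjes_measure a b \<mu>) = sets borel"
  by (simp add: stieltjes_measure_right_limits)

lemma space_stieltjes [simp]: "space (stieltjes_measure a b \<mu>) = UNIV"
  by (simp add: stieltjes_measure_right_limits)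

lemma emeasure_stieltjes_Icc_finite:
  assumes "mono_on {a..b} \<mu>" "a \<le> b"
  shows "emeasure (stieltjes_measure a b \<mu>) {a..b} < \<infinity>"
proof -
  have "emeasure (stieltjes_measure a b \<mu>) {a..b} \<le> emeasure (stieltjes_measure a b \<mu>) {a - 1<..b}"
    by (intro emeasure_mono) auto
  also have "\<dots> < \<infinity>"
    using assms by (simp add: emeasure_stieltjes_Ioc)
  finally show ?thesis .
qed

lemma right_limits_scale:
  assumes "c > 0"
  shows "right_limits 0 (\<tau> / c) (\<lambda>t. \<mu> (c * t)) t = right_limits 0 \<tau> \<mu> (c * t)"
proof -
  have "{c * t<..} = (\<lambda>s. c * s) ` {t<..}"
  proof (intro equalityI subsetI)
    fix x assume "x \<in> {c * t<..}"
    then show "x \<in> (\<lambda>s. c * s) ` {t<..}"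
      using assms by (intro image_eqI[of _ _ "x / c"]) (auto simp: field_simps)
  qed (use assms in auto)
  moreover have "c * max 0 (min (\<tau> / c) s) = max 0 (min \<tau> (c * s))" for s
    using assms by (auto simp: max_def min_def field_simps zero_le_mult_iff mult_le_0_iff)
  ultimately show ?thesis
    by (simp add: right_limits_def image_image)
qed

text \<open>The two distribution functions are related by the same dilation, and a locally finite Borel measure is determined by its
values on half-open intervals.\<close>

lemma stieltjes_measure_scale:
  assumes \<mu>: "mono_on {0..\<tau>} \<mu>" and "0 \<le> \<tau>" "c > 0"
  shows "stieltjes_measure 0 (\<tau> / c) (\<lambda>t. \<mu> (c * t)) = distr (stieltjes_measure 0 \<tau> \<mu>) borel (\<lambda>s. s / c)"
    (is "?L = ?R")
proof (rule measure_eqI_generator_eq)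
  have \<mu>c: "mono_on {0..\<tau> / c} (\<lambda>t. \<mu> (c * t))"
    using assms by (auto simp: mono_on_def field_simps)
  have L: "emeasure ?L {a<..b} = ennreal (right_limits 0 \<tau> \<mu> (c * b) - right_limits 0 \<tau> \<mu> (c * a))"
    if "a \<le> b" for a b
    using emeasure_stieltjes_Ioc[OF \<mu>c _ that] assms by (simp add: right_limits_scale)
  show "Int_stable (range (\<lambda>(a, b). {a<..b::real}))"
    by (auto simp: Int_stable_def)
  show "emeasure ?L X = emeasure ?R X" if "X \<in> range (\<lambda>(a, b). {a<..b})" for X
  proof -
    from that obtain a b where X: "X = {a<..b}" by auto
    show ?thesis
    proof (cases "a \<le> b")
      case True
      have "emeasure ?R X = emeasure (stieltjes_measure 0 \<tau> \<mu>) ((\<lambda>s. s / c) -` X)"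
        by (subst emeasure_distr) (auto simp: X)
      also have "(\<lambda>s. s / c) -` X = {c * a<..c * b}"
        using assms by (auto simp: X field_simps)
      finally show ?thesis
        using L[OF True] emeasure_stieltjes_Ioc[OF \<mu> \<open>0 \<le> \<tau>\<close>, of "c * a" "c * b"] True assms
        by (simp add: X)
    next
      case False
      then have "X = {}" using X by auto
      then show ?thesis by simp
    qed
  qed
  show "range (\<lambda>i::nat. {- real i<..real i}) \<subseteq> range (\<lambda>(a, b). {a<..b})"
    by auto
  show "(\<Union>i::nat. {- real i<..real i}) = UNIV"
  proof (intro equalityI subsetI UNIV_I)
    fix x :: real
    obtain i :: nat where "\<bar>x\<bar> < real i" using reals_Archimedean2 by blast
    then show "x \<in> (\<Union>i::nat. {- real i<..real i})" by (intro UN_I[of i]) auto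
  qed
  show "emeasure ?L {- real i<..real i} \<noteq> \<infinity>" for i
    using L[of "- real i" "real i"] by simp
qed (auto simp: borel_sigma_sets_Ioc)

lemma stieltjes_integral_scale:
  assumes \<mu>: "mono_on {0..\<tau>} \<mu>" and "0 \<le> \<tau>" "c > 0" and g [measurable]: "g \<in> borel_measurable borel"
  shows "stieltjes_integral 0 (\<tau> / c) g (\<lambda>t. \<mu> (c * t)) = stieltjes_integral 0 \<tau> (\<lambda>s. g (s / c)) \<mu>"
proof -
  have "stieltjes_integral 0 (\<tau> / c) g (\<lambda>t. \<mu> (c * t))
      = (\<integral>\<^sup>+s. g (s / c) * indicator {0..\<tau> / c} (s / c) \<partial>stieltjes_measure 0 \<tau> \<mu>)"
    unfolding stieltjes_integral_def stieltjes_measure_scale[OF assms(1-3)]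
    by (subst nn_integral_distr) auto
  also have "\<dots> = stieltjes_integral 0 \<tau> (\<lambda>s. g (s / c)) \<mu>"
    unfolding stieltjes_integral_def using assms(3)
    by (intro nn_integral_cong) (auto simp: indicator_def field_simps)
  finally show ?thesis .
qed

section \<open>The direct estimate\<close>

definition tail_coeff :: "nat \<Rightarrow> (int \<Rightarrow> complex) \<Rightarrow> int \<Rightarrow> complex" where
  "tail_coeff n c = (\<lambda>k. if \<bar>k\<bar> < int n then 0 else c k)"

text \<open>Approximating by the partial sum of the Fourier series removes exactly the frequencies below \<open>n\<close>.\<close>

lemma best_approx_le_tail:
  assumes "f \<in> periodic_L1" "n \<ge> 1"
  shows "best_approx M n f \<le> orlicz_norm M (tail_coeff n (fourier_coeff f))"
proof -
  have "fourier_coeff (\<lambda>x. f x - trig_poly (n - 1) (fourier_coeff f) x) = tail_coeff n (fourier_coeff f)"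
    using assms by (auto simp: fourier_coeff_minus_trig_poly tail_coeff_def fun_eq_iff)
  then show ?thesis
    unfolding best_approx_def by (intro INF_lower2[of "fourier_coeff f"]) simp_all
qed

text \<open>The moduli of \<open>\<psi>\<close> are symmetric and decrease away from zero, so among the frequencies that survive in the tail
the largest multiplier is the one at \<open>n\<close>.\<close>

lemma Psi_class_bound:
  assumes "\<psi> \<in> Psi_class" "n \<ge> 1" "int n \<le> \<bar>k\<bar>"
  shows "cmod (\<psi> k) \<le> cmod (\<psi> (int n))"
proof -
  have \<psi>: "cmod (\<psi> j) = cmod (\<psi> (- j)) \<and> cmod (\<psi> (- j)) \<ge> cmod (\<psi> (j + 1))" if "j \<ge> 1" for j
    using assms(1) that unfolding Psi_class_def by blast
  have "cmod (\<psi> j) \<le> cmod (\<psi> (int n))" if "int n \<le> j" for j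
    using that
  proof (induction rule: int_ge_induct)
    case (step i)
    then show ?case using \<psi>[of i] assms(2) by simp
  qed simp
  from this[of "\<bar>k\<bar>"] show ?thesis
    using assms \<psi>[of "\<bar>k\<bar>"] by (cases "k \<ge> 0") auto
qed

lemma best_approx_le_psi_tail:
  assumes "psi_integral_of \<psi> f g" "\<psi> \<in> Psi_class" "n \<ge> 1"
  shows "best_approx M n f \<le> ennreal (cmod (\<psi> (int n))) * orlicz_norm M (tail_coeff n (fourier_coeff g))"
proof -
  have "best_approx M n f \<le> orlicz_norm M (tail_coeff n (fourier_coeff f))"
    using assms by (intro best_approx_le_tail) (auto simp: psi_integral_of_def)
  also have "\<dots> \<le> orlicz_norm M (\<lambda>k. \<psi> (int n) * tail_coeff n (fourier_coeff g) k)"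
  proof (rule orlicz_norm_mono)
    fix k
    have "fourier_coeff f k = \<psi> k * fourier_coeff g k"
      using assms(1) by (simp add: psi_integral_of_def)
    then show "cmod (tail_coeff n (fourier_coeff f) k) \<le> cmod (\<psi> (int n) * tail_coeff n (fourier_coeff g) k)"
      using Psi_class_bound[OF assms(2,3), of k]
      by (cases "\<bar>k\<bar> < int n") (simp_all add: tail_coeff_def norm_mult mult_right_mono)
  qed
  finally show ?thesis
    by (simp only: orlicz_norm_scale)
qed

text \<open>The heart of the direct estimate. For every frequency of modulus at least \<open>n\<close>, the infimum defining the constant is at
most the integral of \<open>\<phi> (k s / n)\<close>. Weighting these inequalities with \<open>\<lambda>\<^sub>k |c\<^sub>k|\<close>, summing over a finite set
of frequencies and moving the sum under the integral leaves a partial sum of the Orlicz norm of the difference with step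
\<open>s / n\<close>, hence a lower bound of the modulus of smoothness.\<close>

lemma tail_norm_le_modulus_integral:
  assumes \<phi>: "\<phi> \<in> Phi_class" and "n \<ge> 1"
  shows "I_const n \<phi> \<tau> \<mu> * orlicz_norm M (tail_coeff n (fourier_coeff g))
    \<le> stieltjes_integral 0 \<tau> (\<lambda>s. modulus M \<phi> g (s / n)) \<mu>"
  unfolding orlicz_norm_eq_SUP_finite SUP_mult_left_ennreal
proof (intro SUP_least)
  fix l and F :: "int set" assume l: "l \<in> weights M" and "F \<in> {F. finite F}"
  then have F: "finite F" by simp
  define c where "c = fourier_coeff g"
  define x where "x = (\<lambda>k. ennreal (l k * cmod (tail_coeff n c k)))"
  let ?\<nu> = "stieltjes_measure 0 \<tau> \<mu>"
  have \<phi>_cont: "continuous_on UNIV \<phi>" and \<phi>_even: "\<phi> (- t) = \<phi> t" and \<phi>_nonneg: "0 \<le> \<phi> t" for t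
    using \<phi> by (auto simp: Phi_class_def)
  from \<phi>_cont have [measurable]: "\<phi> \<in> borel_measurable borel"
    by (rule borel_measurable_continuous_onI)
  have l_nonneg: "0 \<le> l k" for k
    using l by (auto simp: weights_def intro: less_imp_le)
  have term_le: "I_const n \<phi> \<tau> \<mu> * x k
      \<le> (\<integral>\<^sup>+s. ennreal (\<phi> (of_int k * (s / n))) * x k * indicator {0..\<tau>} s \<partial>?\<nu>)" for k
  proof (cases "\<bar>k\<bar> < int n")
    case False
    \<comment> \<open>The infimum ranges over positive frequencies; evenness of \<open>\<phi>\<close> covers the negative ones.\<close>
    have eq: "\<phi> (real (nat \<bar>k\<bar>) * s / n) = \<phi> (of_int k * (s / n))" for s
      using \<phi>_even[of "of_int k * (s / n)"] by (cases "k \<ge> 0") auto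
    have "I_const n \<phi> \<tau> \<mu> \<le> (\<integral>\<^sup>+s. ennreal (\<phi> (of_int k * (s / n))) * indicator {0..\<tau>} s \<partial>?\<nu>)"
      unfolding I_const_def
    proof (rule INF_lower2[of "nat \<bar>k\<bar>"])
      show "nat \<bar>k\<bar> \<in> {n..}"
        using False by auto
    qed (simp only: stieltjes_integral_def eq order_refl)
    then have "I_const n \<phi> \<tau> \<mu> * x k \<le> (\<integral>\<^sup>+s. ennreal (\<phi> (of_int k * (s / n))) * indicator {0..\<tau>} s \<partial>?\<nu>) * x k"
      by (rule mult_right_mono) simp
    also have "\<dots> = (\<integral>\<^sup>+s. ennreal (\<phi> (of_int k * (s / n))) * indicator {0..\<tau>} s * x k \<partial>?\<nu>)"
      by (subst nn_integral_multc) auto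
    finally show ?thesis
      by (simp add: mult_ac)
  qed (simp add: x_def tail_coeff_def)
  have "I_const n \<phi> \<tau> \<mu> * (\<Sum>k\<in>F. x k)
      \<le> (\<Sum>k\<in>F. \<integral>\<^sup>+s. ennreal (\<phi> (of_int k * (s / n))) * x k * indicator {0..\<tau>} s \<partial>?\<nu>)"
    unfolding sum_distrib_left by (intro sum_mono term_le)
  also have "\<dots> = (\<integral>\<^sup>+s. (\<Sum>k\<in>F. ennreal (\<phi> (of_int k * (s / n))) * x k * indicator {0..\<tau>} s) \<partial>?\<nu>)"
    by (subst nn_integral_sum) auto
  also have "\<dots> \<le> (\<integral>\<^sup>+s. modulus M \<phi> g (s / n) * indicator {0..\<tau>} s \<partial>?\<nu>)"
  proof (intro nn_integral_mono)
    fix s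
    show "(\<Sum>k\<in>F. ennreal (\<phi> (of_int k * (s / n))) * x k * indicator {0..\<tau>} s)
        \<le> modulus M \<phi> g (s / n) * indicator {0..\<tau>} s"
    proof (cases "s \<in> {0..\<tau>}")
      case True
      let ?d = "\<lambda>k. of_real (\<phi> (of_int k * (s / n))) * c k"
      have "(\<Sum>k\<in>F. ennreal (\<phi> (of_int k * (s / n))) * x k) \<le> (\<Sum>k\<in>F. ennreal (l k * cmod (?d k)))"
        using \<phi>_nonneg l_nonneg unfolding x_def
        by (intro sum_mono)
           (auto simp: tail_coeff_def norm_mult ennreal_mult'[symmetric] mult_ac)
      also have "\<dots> \<le> orlicz_norm M ?d"
        by (rule partial_sum_le_orlicz_norm[OF l F])
      also have "\<dots> \<le> modulus M \<phi> g (s / n)"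
        unfolding modulus_def c_def using True by (intro SUP_upper) auto
      finally show ?thesis
        using True by simp
    qed simp
  qed
  finally show "I_const n \<phi> \<tau> \<mu> * (\<Sum>k\<in>F. ennreal (l k * cmod (tail_coeff n (fourier_coeff g) k)))
      \<le> stieltjes_integral 0 \<tau> (\<lambda>s. modulus M \<phi> g (s / n)) \<mu>"
    by (simp add: x_def c_def stieltjes_integral_def)
qed

lemma Mu_class_increment_pos:
  assumes "\<mu> \<in> Mu_class \<tau>"
  shows "\<mu> 0 < \<mu> \<tau>"
proof (rule ccontr)
  assume *: "\<not> \<mu> 0 < \<mu> \<tau>"
  have mono: "mono_on {0..\<tau>} \<mu>" and "\<not> \<mu> constant_on {0..\<tau>}"
    using assms by (auto simp: Mu_class_def)
  moreover have "\<mu> t = \<mu> 0" if "t \<in> {0..\<tau>}" for t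
    using that * mono_onD[OF mono, of 0 t] mono_onD[OF mono, of t \<tau>] by auto
  ultimately show False
    unfolding constant_on_def by blast
qed

text \<open>Finiteness makes it legitimate to divide by the constant: \<open>\<phi>\<close> is bounded and the Stieltjes measure is finite.\<close>

lemma I_const_finite:
  assumes \<phi>: "\<phi> \<in> Phi_class" and \<mu>: "mono_on {0..\<tau>} \<mu>" "0 \<le> \<tau>"
  shows "I_const n \<phi> \<tau> \<mu> < \<infinity>"
proof -
  obtain B where "\<forall>x\<in>range \<phi>. norm x \<le> B"
    using \<phi> unfolding Phi_class_def bounded_iff by blast
  then have B: "\<phi> t \<le> B" for t
    using abs_ge_self[of "\<phi> t"] by (force intro: order_trans)
  have "I_const n \<phi> \<tau> \<mu> \<le> stieltjes_integral 0 \<tau> (\<lambda>t. ennreal (\<phi> (real n * t / real n))) \<mu>"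
    unfolding I_const_def by (intro INF_lower) auto
  also have "\<dots> \<le> stieltjes_integral 0 \<tau> (\<lambda>t. ennreal B) \<mu>"
    unfolding stieltjes_integral_def using B
    by (intro nn_integral_mono mult_right_mono ennreal_leI) auto
  also have "\<dots> = ennreal B * emeasure (stieltjes_measure 0 \<tau> \<mu>) {0..\<tau>}"
    unfolding stieltjes_integral_def by (subst nn_integral_cmult_indicator) auto
  also have "\<dots> < \<infinity>"
    using emeasure_stieltjes_Icc_finite[OF \<mu>] by (simp add: ennreal_mult_less_top)
  finally show ?thesis .
qed

text \<open>The dilation turns the averaged modulus at scale \<open>\<tau> / n\<close> into an integral with respect to \<open>\<mu>\<close> itself.\<close>

lemma Omega_modulus_eq:
  assumes "mono_on {0..\<tau>} \<mu>" "\<tau> > 0" "n \<ge> 1"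
  shows "Omega_modulus M \<phi> g \<tau> \<mu> (\<tau> / real n)
    = 1 / ennreal (\<mu> \<tau> - \<mu> 0) * stieltjes_integral 0 \<tau> (\<lambda>s. modulus M \<phi> g (s / n)) \<mu>"
proof -
  have "\<tau> * t / (\<tau> / real n) = real n * t" for t
    using assms(2) by simp
  then show ?thesis
    unfolding Omega_modulus_def using assms
    by (simp only: stieltjes_integral_scale[OF assms(1) _ _ borel_measurable_mono_ennreal[OF modulus_mono]]
        less_imp_le of_nat_0_less_iff less_le_trans[OF zero_less_one])
qed

lemma ennreal_cancel_increment:
  fixes a :: ennreal
  assumes "0 < a" "a < \<infinity>"
  shows "a / i * p * (1 / a * x) = p * (x / i)"
proof -
  have "a / i * p * (1 / a * x) = (a / a) * (p * (x / i))"
    by (simp add: divide_ennreal_def mult_ac)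
  also have "a / a = 1"
    using assms by (intro ennreal_divide_self) auto
  finally show ?thesis by simp
qed

lemma jackson_inequality:
  assumes \<phi>: "\<phi> \<in> Phi_class" and \<tau>: "\<tau> > 0" and \<mu>: "\<mu> \<in> Mu_class \<tau>" and \<psi>: "\<psi> \<in> Psi_class" and n: "n \<ge> 1"
    and I_pos: "I_const n \<phi> \<tau> \<mu> > 0" and fg: "psi_integral_of \<psi> f g"
  shows "best_approx M n f
    \<le> ennreal (\<mu> \<tau> - \<mu> 0) / I_const n \<phi> \<tau> \<mu> * ennreal (cmod (\<psi> (int n)))
      * Omega_modulus M \<phi> g \<tau> \<mu> (\<tau> / real n)"
proof -
  let ?I = "I_const n \<phi> \<tau> \<mu>" and ?N = "orlicz_norm M (tail_coeff n (fourier_coeff g))"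
    and ?X = "stieltjes_integral 0 \<tau> (\<lambda>s. modulus M \<phi> g (s / n)) \<mu>"
  have mono: "mono_on {0..\<tau>} \<mu>"
    using \<mu> by (simp add: Mu_class_def)
  have I_fin: "?I < \<infinity>"
    using I_const_finite[OF \<phi> mono] \<tau> by simp
  have "?N = ?N * ?I / ?I"
    using I_pos I_fin by (intro mult_divide_eq_ennreal[symmetric]) auto
  also have "\<dots> \<le> ?X / ?I"
    using tail_norm_le_modulus_integral[OF \<phi> n] by (intro divide_right_mono_ennreal) (simp add: mult.commute)
  finally have N: "?N \<le> ?X / ?I" .
  have "best_approx M n f \<le> ennreal (cmod (\<psi> (int n))) * ?N"
    by (rule best_approx_le_psi_tail[OF fg \<psi> n])
  also have "\<dots> \<le> ennreal (cmod (\<psi> (int n))) * (?X / ?I)"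
    by (intro mult_left_mono N) simp
  also have "\<dots> = ennreal (\<mu> \<tau> - \<mu> 0) / ?I * ennreal (cmod (\<psi> (int n))) * (1 / ennreal (\<mu> \<tau> - \<mu> 0) * ?X)"
    using Mu_class_increment_pos[OF \<mu>] by (intro ennreal_cancel_increment[symmetric]) auto
  finally show ?thesis
    unfolding Omega_modulus_eq[OF mono \<tau> n] .
qed

section \<open>The extremal harmonic\<close>

text \<open>The function \<open>z e\<^sup>i\<^sup>n\<^sup>x\<close>, written as a trigonometric polynomial so that its Fourier coefficients need no separate
computation.\<close>

definition harmonic :: "nat \<Rightarrow> complex \<Rightarrow> real \<Rightarrow> complex" where
  "harmonic n z = trig_poly n (\<lambda>k. z * unit_seq (int n) k)"

lemma harmonic_periodic_L1: "harmonic n z \<in> periodic_L1"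
  by (simp add: harmonic_def trig_poly_periodic_L1)

lemma fourier_coeff_harmonic:
  "fourier_coeff (harmonic n z) k = z * unit_seq (int n) k"
  by (auto simp: harmonic_def fourier_coeff_trig_poly unit_seq_def)

text \<open>No polynomial of degree below \<open>n\<close> changes the coefficient at \<open>n\<close>.\<close>

lemma best_approx_harmonic_ge:
  assumes "n \<ge> 1"
  shows "ennreal (cmod z) * orlicz_norm M (unit_seq (int n))
    \<le> best_approx M n (harmonic n z)"
  unfolding best_approx_def orlicz_norm_scale[symmetric]
  using assms
  by (intro INF_greatest orlicz_norm_mono)
     (auto simp: fourier_coeff_minus_trig_poly[OF harmonic_periodic_L1] fourier_coeff_harmonic, auto simp: unit_seq_def)

text \<open>Differences act on a single harmonic through the factor \<open>\<phi> (n h)\<close> alone, and monotonicity of \<open>\<phi>\<close> on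
\<open>[0, \<tau>]\<close> makes the largest admissible step the worst one.\<close>

lemma modulus_harmonic_le:
  assumes \<phi>: "\<phi> \<in> Phi_class" and mono: "mono_on {0..\<tau>} \<phi>" and "n \<ge> 1" and s: "s \<in> {0..\<tau>}"
  shows "modulus M \<phi> (harmonic n 1) (s / n)
    \<le> ennreal (\<phi> s) * orlicz_norm M (unit_seq (int n))"
  unfolding modulus_def fourier_coeff_harmonic
proof (rule SUP_least)
  fix h assume "h \<in> {h. \<bar>h\<bar> \<le> s / n}"
  then have h: "\<bar>real n * h\<bar> \<le> s"
    using \<open>n \<ge> 1\<close> by (simp add: abs_mult field_simps)
  have nonneg: "0 \<le> \<phi> t" and even: "\<phi> \<bar>t\<bar> = \<phi> t" for t
    using \<phi> by (auto simp: Phi_class_def abs_if)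
  have "\<phi> (real n * h) \<le> \<phi> s"
    using mono_onD[OF mono, of "\<bar>real n * h\<bar>" s] h s even by auto
  then have "orlicz_norm M (\<lambda>k. of_real (\<phi> (of_int k * h)) * (1 * unit_seq (int n) k))
      \<le> orlicz_norm M (\<lambda>k. of_real (\<phi> s) * unit_seq (int n) k)"
    using nonneg by (intro orlicz_norm_mono) (auto simp: unit_seq_def)
  also have "\<dots> = ennreal (\<phi> s) * orlicz_norm M (unit_seq (int n))"
    using nonneg by (simp add: orlicz_norm_scale)
  finally show "orlicz_norm M (\<lambda>k. of_real (\<phi> (of_int k * h)) * (1 * unit_seq (int n) k))
      \<le> ennreal (\<phi> s) * orlicz_norm M (unit_seq (int n))" .
qed

lemma modulus_integral_harmonic_le:
  assumes \<phi>: "\<phi> \<in> Phi_class" and "mono_on {0..\<tau>} \<phi>" and "n \<ge> 1"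
  shows "stieltjes_integral 0 \<tau> (\<lambda>s. modulus M \<phi> (harmonic n 1) (s / n)) \<mu>
    \<le> stieltjes_integral 0 \<tau> (\<lambda>s. ennreal (\<phi> s)) \<mu> * orlicz_norm M (unit_seq (int n))"
proof -
  have [measurable]: "\<phi> \<in> borel_measurable borel"
    using \<phi> by (auto simp: Phi_class_def intro: borel_measurable_continuous_onI)
  have "stieltjes_integral 0 \<tau> (\<lambda>s. modulus M \<phi> (harmonic n 1) (s / n)) \<mu>
      \<le> (\<integral>\<^sup>+s. ennreal (\<phi> s) * indicator {0..\<tau>} s * orlicz_norm M (unit_seq (int n)) \<partial>stieltjes_measure 0 \<tau> \<mu>)"
    unfolding stieltjes_integral_def
  proof (intro nn_integral_mono)
    fix s
    show "modulus M \<phi> (harmonic n 1) (s / n) * indicator {0..\<tau>} s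
        \<le> ennreal (\<phi> s) * indicator {0..\<tau>} s * orlicz_norm M (unit_seq (int n))"
      using modulus_harmonic_le[OF assms, of s M] by (cases "s \<in> {0..\<tau>}") auto
  qed
  also have "\<dots> = stieltjes_integral 0 \<tau> (\<lambda>s. ennreal (\<phi> s)) \<mu> * orlicz_norm M (unit_seq (int n))"
    unfolding stieltjes_integral_def by (subst nn_integral_multc) auto
  finally show ?thesis .
qed

text \<open>In the extended half-line the cancellation needs both unit norm \<open>S\<close> and increment \<open>a\<close> to be positive and finite. When
\<open>i = 0\<close> the quotient \<open>a / i\<close> is infinite, but the premise then forces \<open>p = 0\<close>, and \<open>\<infinity> * 0 = 0\<close>.\<close>

lemma constant_lower_bound:
  fixes a p i S C :: ennreal
  assumes a: "0 < a" "a < \<infinity>" and S: "0 < S" "S < \<infinity>" and i: "i < \<infinity>"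
    and le: "p * S \<le> C * (1 / a * (i * S))"
  shows "a / i * p \<le> C"
proof -
  have "p = p * S / S"
    using S by (intro mult_divide_eq_ennreal[symmetric]) auto
  also have "\<dots> \<le> C * (1 / a * i) * S / S"
    using le by (intro divide_right_mono_ennreal) (simp add: mult_ac)
  also have "\<dots> = C * (1 / a * i)"
    using S by (intro mult_divide_eq_ennreal) auto
  finally have p: "p \<le> C * (1 / a * i)" .
  show ?thesis
  proof (cases "i = 0")
    case True
    with p show ?thesis by simp
  next
    case False
    have "a / i * p \<le> a / i * C * (1 / a * i)"
      using mult_left_mono[OF p, of "a / i"] by (simp add: mult_ac)
    also have "\<dots> = C * (i / i)"
      using a by (rule ennreal_cancel_increment)
    also have "i / i = 1"
      using False i by (intro ennreal_divide_self)  auto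
    finally show ?thesis by simp
  qed
qed

lemma harmonic_not_ae_const:
  assumes "n \<ge> 1" "z \<noteq> 0"
  shows "\<not> ae_const (harmonic n z)"
proof
  assume "ae_const (harmonic n z)"
  then obtain c where "AE x in lebesgue. harmonic n z x = c"
    by (auto simp: ae_const_def)
  then have "fourier_coeff (harmonic n z) (int n) = 0"
    using harmonic_periodic_L1[of n z] assms
    by (intro fourier_coeff_ae_const) (auto simp: periodic_L1_def)
  then show False
    using assms by (simp add: fourier_coeff_harmonic unit_seq_def)
qed

lemma harmonic_psi_derivative:
  assumes "\<forall>k. orlicz_function (M k)"
  shows "harmonic n 1 \<in> psi_derivs \<psi> M (harmonic n (\<psi> (int n)))"
proof -
  have coeff: "fourier_coeff (harmonic n 1) = unit_seq (int n)"
    by (simp add: fourier_coeff_harmonic fun_eq_iff)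
  have "harmonic n 1 \<in> SM_space M"
    using luxemburg_norm_unit_seq_finite[OF assms]
    by (simp add: SM_space_def harmonic_periodic_L1 coeff)
  moreover have "psi_integral_of \<psi> (harmonic n (\<psi> (int n))) (harmonic n 1)"
    by (auto simp: psi_integral_of_def harmonic_periodic_L1 fourier_coeff_harmonic unit_seq_def)
  ultimately show ?thesis
    by (simp add: psi_derivs_def)
qed

lemma harmonic_Lpsi_SM:
  assumes "\<forall>k. orlicz_function (M k)"
  shows "harmonic n (\<psi> (int n)) \<in> Lpsi_SM \<psi> M"
  using harmonic_psi_derivative[OF assms, of n \<psi>] by (auto simp: Lpsi_SM_def psi_derivs_def)

lemma Omega_modulus_harmonic_le:
  assumes "\<phi> \<in> Phi_class" "\<tau> > 0" "\<mu> \<in> Mu_class \<tau>" "n \<ge> 1" "mono_on {0..\<tau>} \<phi>"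
    and I: "I_const n \<phi> \<tau> \<mu> = stieltjes_integral 0 \<tau> (\<lambda>t. ennreal (\<phi> t)) \<mu>"
  shows "Omega_modulus M \<phi> (harmonic n 1) \<tau> \<mu> (\<tau> / real n)
    \<le> 1 / ennreal (\<mu> \<tau> - \<mu> 0) * (I_const n \<phi> \<tau> \<mu> * orlicz_norm M (unit_seq (int n)))"
proof -
  have "mono_on {0..\<tau>} \<mu>"
    using assms(3) by (simp add: Mu_class_def)
  then show ?thesis
    using assms modulus_integral_harmonic_le[OF assms(1,5,4), of M \<mu>]
    by (simp only: Omega_modulus_eq mult_left_mono zero_le)
qed

text \<open>Testing an inequality on one harmonic bounds its constant from below: the numerator is at least \<open>|z| S\<close>, the averaged modulus
at most \<open>I S / (\<mu> \<tau> - \<mu> 0)\<close>, and the norm \<open>S\<close> of the unit sequence cancels.\<close>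

lemma jackson_constant_optimal:
  assumes orlicz: "\<forall>k. orlicz_function (M k)"
    and conj: "\<forall>k. conjugate (M k) 1 = 1 \<and> (\<forall>v>1. conjugate (M k) v > conjugate (M k) 1)"
    and \<phi>: "\<phi> \<in> Phi_class" and \<tau>: "\<tau> > 0" and \<mu>: "\<mu> \<in> Mu_class \<tau>" and n: "n \<ge> 1"
    and mono: "mono_on {0..\<tau>} \<phi>"
    and I: "I_const n \<phi> \<tau> \<mu> = stieltjes_integral 0 \<tau> (\<lambda>t. ennreal (\<phi> t)) \<mu>"
    and le: "best_approx M n (harmonic n z) \<le> C * Omega_modulus M \<phi> (harmonic n 1) \<tau> \<mu> (\<tau> / real n)"
  shows "ennreal (\<mu> \<tau> - \<mu> 0) / I_const n \<phi> \<tau> \<mu> * ennreal (cmod z) \<le> C"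
proof (rule constant_lower_bound)
  let ?S = "orlicz_norm M (unit_seq (int n))"
  show "0 < ennreal (\<mu> \<tau> - \<mu> 0)"
    using Mu_class_increment_pos[OF \<mu>] by simp
  show "0 < ?S"
    using orlicz_norm_unit_seq_pos orlicz conj by blast
  show "?S < \<infinity>"
    using orlicz_norm_unit_seq_le_1[OF conj, of "int n"] by (auto intro: le_less_trans)
  show "I_const n \<phi> \<tau> \<mu> < \<infinity>"
    using I_const_finite[OF \<phi>] \<mu> \<tau> by (simp add: Mu_class_def)
  have "ennreal (cmod z) * ?S \<le> best_approx M n (harmonic n z)"
    by (rule best_approx_harmonic_ge[OF n])
  also note le
  also have "C * Omega_modulus M \<phi> (harmonic n 1) \<tau> \<mu> (\<tau> / real n)
      \<le> C * (1 / ennreal (\<mu> \<tau> - \<mu> 0) * (I_const n \<phi> \<tau> \<mu> * ?S))"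
    by (intro mult_left_mono Omega_modulus_harmonic_le[OF \<phi> \<tau> \<mu> n mono I]) simp
  finally show "ennreal (cmod z) * ?S \<le> C * (1 / ennreal (\<mu> \<tau> - \<mu> 0) * (I_const n \<phi> \<tau> \<mu> * ?S))" .
qed simp

lemma Omega_modulus_harmonic_finite:
  assumes conj: "\<forall>k. conjugate (M k) 1 = 1 \<and> (\<forall>v>1. conjugate (M k) v > conjugate (M k) 1)"
    and \<phi>: "\<phi> \<in> Phi_class" and \<tau>: "\<tau> > 0" and \<mu>: "\<mu> \<in> Mu_class \<tau>" and n: "n \<ge> 1"
    and mono: "mono_on {0..\<tau>} \<phi>"
    and I: "I_const n \<phi> \<tau> \<mu> = stieltjes_integral 0 \<tau> (\<lambda>t. ennreal (\<phi> t)) \<mu>"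
  shows "Omega_modulus M \<phi> (harmonic n 1) \<tau> \<mu> (\<tau> / real n) < \<infinity>"
proof -
  have S: "orlicz_norm M (unit_seq (int n)) < \<infinity>"
    using orlicz_norm_unit_seq_le_1[OF conj, of "int n"] by (auto intro: le_less_trans)
  have "1 / ennreal (\<mu> \<tau> - \<mu> 0) < \<infinity>"
    using Mu_class_increment_pos[OF \<mu>] by (simp add: less_top[symmetric] ennreal_divide_eq_top_iff)
  moreover have "I_const n \<phi> \<tau> \<mu> < \<infinity>"
    using I_const_finite[OF \<phi>] \<mu> \<tau> by (simp add: Mu_class_def)
  ultimately have "1 / ennreal (\<mu> \<tau> - \<mu> 0) * (I_const n \<phi> \<tau> \<mu> * orlicz_norm M (unit_seq (int n))) < \<infinity>"
    using S by (simp add: ennreal_mult_less_top)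
  then show ?thesis
    using Omega_modulus_harmonic_le[OF \<phi> \<tau> \<mu> n mono I] by (rule le_less_trans[rotated])
qed

lemma ennreal_quotient_le:
  fixes E C x :: ennreal
  assumes "E \<le> C * x"
  shows "E / x \<le> C"
proof (cases "x = 0 \<or> x = \<infinity>")
  case False
  then have "E / x \<le> C * x / x"
    using assms by (intro divide_right_mono_ennreal)
  also have "\<dots> = C"
    using False by (intro mult_divide_eq_ennreal) auto
  finally show ?thesis .
qed (use assms in auto)

text \<open>Finiteness of the constant excludes a vanishing denominator below a nonzero numerator, for which the quotient is infinite.\<close>

lemma le_of_ennreal_quotient_le:
  fixes E C x :: ennreal
  assumes "E / x \<le> C" "x < \<infinity>" "C < \<infinity>"
  shows "E \<le> C * x"
proof (cases "x = 0")
  case True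
  have "E = 0"
  proof (rule ccontr)
    assume "E \<noteq> 0"
    with True assms show False by simp
  qed
  then show ?thesis by simp
next
  case False
  have "E = E / x * x"
    using False assms(2) by (simp add: ennreal_divide_times)
  also have "\<dots> \<le> C * x"
    using assms(1) by (rule mult_right_mono) simp
  finally show ?thesis .
qed

section \<open>The sharp inequality\<close>

theorem theorem3p1:
  fixes M :: "int \<Rightarrow> real \<Rightarrow> real" and \<psi> :: "int \<Rightarrow> complex"
    and \<phi> \<mu> :: "real \<Rightarrow> real" and \<tau> :: real and n :: nat
  assumes "\<forall>k. orlicz_function (M k)"
    and "\<forall>k. conjugate (M k) 1 = 1 \<and> (\<forall>v>1. conjugate (M k) v > conjugate (M k) 1)"
    and "\<phi> \<in> Phi_class"
    and "\<tau> > 0"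
    and "\<mu> \<in> Mu_class \<tau>"
    and "\<psi> \<in> Psi_class"
    and "n \<ge> 1"
  shows
    "(I_const n \<phi> \<tau> \<mu> > 0 \<longrightarrow>
        (\<forall>f\<in>Lpsi_SM \<psi> M. \<forall>g\<in>psi_derivs \<psi> M f.
           best_approx M n f
             \<le> ennreal (\<mu> \<tau> - \<mu> 0) / I_const n \<phi> \<tau> \<mu> * ennreal (cmod (\<psi> (int n)))
               * Omega_modulus M \<phi> g \<tau> \<mu> (\<tau> / real n)))
     \<and>
     (mono_on {0..\<tau>} \<phi> \<and>
      I_const n \<phi> \<tau> \<mu> = stieltjes_integral 0 \<tau> (\<lambda>t. ennreal (\<phi> t)) \<mu> \<longrightarrow>
        (\<forall>C::ennreal.
           (\<forall>f\<in>Lpsi_SM \<psi> M. \<forall>g\<in>psi_derivs \<psi> M f.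
              best_approx M n f \<le> C * Omega_modulus M \<phi> g \<tau> \<mu> (\<tau> / real n))
           \<longrightarrow> ennreal (\<mu> \<tau> - \<mu> 0) / I_const n \<phi> \<tau> \<mu> * ennreal (cmod (\<psi> (int n))) \<le> C)
        \<and>
        (SUP (f, g)\<in>{(f, g). f \<in> Lpsi_SM \<psi> M \<and> \<not> ae_const f \<and> g \<in> psi_derivs \<psi> M f}.
           best_approx M n f / Omega_modulus M \<phi> g \<tau> \<mu> (\<tau> / real n))
        = ennreal (\<mu> \<tau> - \<mu> 0) / stieltjes_integral 0 \<tau> (\<lambda>t. ennreal (\<phi> t)) \<mu>
          * ennreal (cmod (\<psi> (int n))))"
proof -
  let ?a = "ennreal (\<mu> \<tau> - \<mu> 0)" and ?I = "I_const n \<phi> \<tau> \<mu>" and ?p = "ennreal (cmod (\<psi> (int n)))"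
  let ?\<Omega> = "\<lambda>g. Omega_modulus M \<phi> g \<tau> \<mu> (\<tau> / real n)"
  let ?f = "harmonic n (\<psi> (int n))" and ?g = "harmonic n 1"
  note orlicz = assms(1) and conj = assms(2) and \<phi> = assms(3) and \<tau> = assms(4) and \<mu> = assms(5)
    and \<psi> = assms(6) and n = assms(7)
  have direct: "best_approx M n f \<le> ?a / ?I * ?p * ?\<Omega> g" if "?I > 0" "g \<in> psi_derivs \<psi> M f" for f g
    using that by (intro jackson_inequality[OF \<phi> \<tau> \<mu> \<psi> n]) (auto simp: psi_derivs_def)
  have quotient: "best_approx M n f / ?\<Omega> g \<le> ?a / ?I * ?p" if g: "g \<in> psi_derivs \<psi> M f" for f g
  proof (cases "?I = 0")
    case False
    then show ?thesis
      using direct[OF _ g] by (intro ennreal_quotient_le) (simp add: zero_less_iff_neq_zero)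
  next
    case True
    show ?thesis
    proof (cases "?p = 0")
      case p: True
      have "best_approx M n f \<le> ?p * orlicz_norm M (tail_coeff n (fourier_coeff g))"
        using g by (intro best_approx_le_psi_tail[OF _ \<psi> n]) (simp add: psi_derivs_def)
      then have "best_approx M n f = 0"
        unfolding p by simp
      then show ?thesis by simp
    next
      case False
      have "?a / ?I * ?p = \<infinity>"
        using True False Mu_class_increment_pos[OF \<mu>] by (simp add: ennreal_top_mult)
      then show ?thesis by simp
    qed
  qed
  have pair: "?f \<in> Lpsi_SM \<psi> M" "?g \<in> psi_derivs \<psi> M ?f"
    using harmonic_Lpsi_SM[OF orlicz] harmonic_psi_derivative[OF orlicz] by auto
  show ?thesis
  proof (intro conjI impI allI ballI; (elim conjE)?)
    fix f g assume "?I > 0" "g \<in> psi_derivs \<psi> M f"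
    then show "best_approx M n f \<le> ?a / ?I * ?p * ?\<Omega> g"
      by (rule direct)
  next
    fix C assume mono: "mono_on {0..\<tau>} \<phi>" and I: "?I = stieltjes_integral 0 \<tau> (\<lambda>t. ennreal (\<phi> t)) \<mu>"
      and C: "\<forall>f\<in>Lpsi_SM \<psi> M. \<forall>g\<in>psi_derivs \<psi> M f. best_approx M n f \<le> C * ?\<Omega> g"
    show "?a / ?I * ?p \<le> C"
      using C pair by (intro jackson_constant_optimal[OF orlicz conj \<phi> \<tau> \<mu> n mono I]) blast
  next
    assume mono: "mono_on {0..\<tau>} \<phi>" and I: "?I = stieltjes_integral 0 \<tau> (\<lambda>t. ennreal (\<phi> t)) \<mu>"
    define Q where "Q = (SUP (f, g)\<in>{(f, g). f \<in> Lpsi_SM \<psi> M \<and> \<not> ae_const f \<and> g \<in> psi_derivs \<psi> M f}.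
      best_approx M n f / ?\<Omega> g)"
    have "Q \<le> ?a / ?I * ?p"
      unfolding Q_def using quotient by (intro SUP_least) auto
    moreover have "?a / ?I * ?p \<le> Q"
      \<comment> \<open>For \<open>\<psi> n = 0\<close> the extremal pair is degenerate, since its first component is constant; but then the left-hand
        side vanishes, even with an infinite first factor.\<close>
    proof (cases "\<psi> (int n) = 0 \<or> Q = \<infinity>")
      case False
      have "best_approx M n ?f / ?\<Omega> ?g \<le> Q"
        unfolding Q_def using pair harmonic_not_ae_const[OF n] False by (intro SUP_upper2[of "(?f, ?g)"]) auto
      then have "best_approx M n ?f \<le> Q * ?\<Omega> ?g"
        using False Omega_modulus_harmonic_finite[OF conj \<phi> \<tau> \<mu> n mono I]
        by (intro le_of_ennreal_quotient_le) (auto simp: less_top)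
      then show ?thesis
        by (rule jackson_constant_optimal[OF orlicz conj \<phi> \<tau> \<mu> n mono I])
    qed auto
    ultimately show "Q = ?a / stieltjes_integral 0 \<tau> (\<lambda>t. ennreal (\<phi> t)) \<mu> * ?p"
      unfolding I by (rule antisym)
  qed
qed

end
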